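(* Let $R$ be an integral domain. If every ideal in $R[X]$ is power stable, then $R$ is a field.
   Context: All rings are commutative with identity. An ideal $I$ of $R[X]$ is called power stable if $I^t\cap R=(I\cap R)^t$ for all $t\geq 1$. *)

theory Defs
  imports "HOL-Algebra.Algebra"
begin

text \<open>
  \<open>UP R\<close> does not literally contain \<open>R\<close>; an element \<open>a\<close> of \<open>R\<close> is identified with the constant
  polynomial \<open>monom (UP R) a 0\<close>. The intersection of \<open>I\<close> with \<open>R\<close> is thus the preimage of \<open>I\<close>
  under this embedding, taken on the carrier of \<open>R\<close>.
\<close>

definition contraction :: "('a, 'm) ring_scheme \<Rightarrow> (nat \<Rightarrow> 'a) set \<Rightarrow> 'a set"
  where "contraction R I = {a \<in> carrier R. monom (UP R) a 0 \<in> I}"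

text \<open>
  The multiplication of \<open>ideals_set S\<close> is the product of ideals of \<open>S\<close> (finite sums of products,
  not elementwise products) and its unit is \<open>carrier S\<close>, so the powers below are ideal powers.
\<close>

definition power_stable :: "('a, 'm) ring_scheme \<Rightarrow> (nat \<Rightarrow> 'a) set \<Rightarrow> bool"
  where "power_stable R I \<longleftrightarrow>
    (\<forall>t::nat. t \<ge> 1 \<longrightarrow>
       contraction R (I [^]\<^bsub>ideals_set (UP R)\<^esub> t) = (contraction R I) [^]\<^bsub>ideals_set R\<^esub> t)"

end

theory Submission
  imports Defs
begin

text \<open>
  Let \<open>a \<noteq> 0\<close> in \<open>R\<close> and \<open>I = (a\<^sup>2, aX, X\<^sup>2 - a)\<close>. Multiplication by \<open>X\<close> preserves the
  conditions \<open>p\<^sub>0 + a p\<^sub>2 \<in> (a\<^sup>2)\<close> and \<open>p\<^sub>1 \<in> (a)\<close> on the coefficients of \<open>p\<close>, which the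
  generators of \<open>I\<close> satisfy; hence \<open>I \<inter> R = (a\<^sup>2)\<close>. But \<open>a\<^sup>3 = (aX)\<^sup>2 - a\<^sup>2 (X\<^sup>2 - a)\<close> lies
  in \<open>I\<^sup>2\<close>, so power stability gives \<open>a\<^sup>3 \<in> (a\<^sup>4)\<close>, and \<open>a\<close> is a unit.
\<close>

lemma (in cring) ideals_set_pow_2:
  assumes "ideal I R"
  shows "I [^]\<^bsub>ideals_set R\<^esub> (2::nat) = I \<cdot> I"
proof -
  interpret S: semiring "ideals_set R"
    by (rule ideals_set_is_semiring)
  have "I \<in> carrier (ideals_set R)"
    using assms by (simp add: ideals_set_def)
  then show ?thesis
    by (simp add: numeral_2_eq_2) (simp add: ideals_set_def)
qed

text \<open>The elementwise product of the two principal ideals is already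
  \<open>PIdl (a \<otimes> b)\<close>; this is an ideal, so generating an ideal from it adds
  nothing.\<close>

lemma (in cring) cgenideal_ideal_prod:
  assumes "a \<in> carrier R" "b \<in> carrier R"
  shows "(PIdl a) \<cdot> (PIdl b) = PIdl (a \<otimes> b)"
proof -
  interpret J: ideal "PIdl (a \<otimes> b)" R
    using assms by (simp add: cgenideal_ideal)
  have "Idl (PIdl (a \<otimes> b)) = PIdl (a \<otimes> b)"
    by (rule equalityI[OF genideal_minimal[OF J.is_ideal order_refl] genideal_self[OF J.a_subset]])
  then show ?thesis
    using assms by (simp add: ideal_prod_eq_genideal cgenideal_ideal cgenideal_prod)
qed

lemma (in cring) mem_cgenideal_mult:
  assumes "a \<in> carrier R" "x \<in> PIdl a"
  shows "a \<otimes> x \<in> PIdl (a \<otimes> a)"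
  using assms by (auto simp: cgenideal_def m_ac)

context UP_cring
begin

text \<open>
  The ideal \<open>(a\<^sup>2, aX, X\<^sup>2 - a)\<close>, given by linear conditions on coefficients so that its
  contraction can be read off.
\<close>

definition witness_ideal :: "'a \<Rightarrow> (nat \<Rightarrow> 'a) set"
  where "witness_ideal a = {p \<in> carrier P.
    up_ring.coeff P p 0 \<oplus> a \<otimes> up_ring.coeff P p 2 \<in> PIdl (a \<otimes> a) \<and>
    up_ring.coeff P p 1 \<in> PIdl a}"

text \<open>Treats an arbitrary multiplier at once rather than powers of X, since only coefficients
  of degree at most 2 enter the conditions.\<close>

lemma witness_ideal_mult_closed:
  assumes a: "a \<in> carrier R" and p: "p \<in> witness_ideal a" and q: "q \<in> carrier P"
  shows "q \<otimes>\<^bsub>P\<^esub> p \<in> witness_ideal a"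
proof -
  interpret J: ideal "PIdl (a \<otimes> a)" R
    using a by (simp add: R.cgenideal_ideal)
  interpret A: ideal "PIdl a" R
    using a by (rule R.cgenideal_ideal)
  define p0 p1 p2 q0 q1 q2 where pq:
    "p0 = up_ring.coeff P p 0" "p1 = up_ring.coeff P p 1" "p2 = up_ring.coeff P p 2"
    "q0 = up_ring.coeff P q 0" "q1 = up_ring.coeff P q 1" "q2 = up_ring.coeff P q 2"
  have pP: "p \<in> carrier P"
    using p by (simp add: witness_ideal_def)
  have c: "p0 \<in> carrier R" "p1 \<in> carrier R" "p2 \<in> carrier R"
      "q0 \<in> carrier R" "q1 \<in> carrier R" "q2 \<in> carrier R"
    using pP q by (simp_all add: pq)
  have r: "p0 \<oplus> a \<otimes> p2 \<in> PIdl (a \<otimes> a)" and p1: "p1 \<in> PIdl a"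
    using p by (simp_all add: witness_ideal_def pq)
  \<comment> \<open>The first condition, read modulo \<open>a\<close>, forces \<open>p0\<close> into
    \<open>PIdl a\<close>; this is what the degree 1 coefficient of the product needs.\<close>
  have "PIdl (a \<otimes> a) \<subseteq> PIdl a"
    using a by (intro R.cgenideal_minimal A.I_l_closed R.cgenideal_self R.cgenideal_ideal)
  then have "p0 \<oplus> a \<otimes> p2 \<in> PIdl a"
    using r by blast
  moreover have "p0 = (p0 \<oplus> a \<otimes> p2) \<ominus> p2 \<otimes> a"
    using a c by (simp add: R.minus_eq R.a_assoc R.r_neg R.m_comm)
  moreover have "p2 \<otimes> a \<in> PIdl a"
    using a c by (simp add: A.I_l_closed R.cgenideal_self)
  ultimately have p0: "p0 \<in> PIdl a"
    by (metis A.a_closed A.a_inv_closed R.minus_eq)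
  have m: "up_ring.coeff P (q \<otimes>\<^bsub>P\<^esub> p) 0 = q0 \<otimes> p0"
    "up_ring.coeff P (q \<otimes>\<^bsub>P\<^esub> p) 1 = q1 \<otimes> p0 \<oplus> q0 \<otimes> p1"
    "up_ring.coeff P (q \<otimes>\<^bsub>P\<^esub> p) 2 = q2 \<otimes> p0 \<oplus> (q1 \<otimes> p1 \<oplus> q0 \<otimes> p2)"
    using pP q by (simp_all add: pq numeral_2_eq_2 Pi_def)
  \<comment> \<open>The terms in \<open>q0\<close> reassemble the condition on \<open>p\<close>. The
    rest lies in \<open>PIdl (a \<otimes> a)\<close> because \<open>p0\<close> and \<open>p1\<close>
    are multiples of \<open>a\<close> and the weight of the degree 2 coefficient supplies a second
    factor \<open>a\<close>.\<close>
  have "q0 \<otimes> p0 \<oplus> a \<otimes> (q2 \<otimes> p0 \<oplus> (q1 \<otimes> p1 \<oplus> q0 \<otimes> p2))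
      = q0 \<otimes> (p0 \<oplus> a \<otimes> p2) \<oplus> (q2 \<otimes> (a \<otimes> p0) \<oplus> q1 \<otimes> (a \<otimes> p1))"
    using a c by (simp add: R.r_distr R.m_ac R.a_ac)
  also have "\<dots> \<in> PIdl (a \<otimes> a)"
    using a c r p0 p1 by (simp add: J.I_l_closed R.mem_cgenideal_mult)
  finally show ?thesis
    using pP q c p0 p1 by (simp add: witness_ideal_def m A.I_l_closed del: One_nat_def)
qed

lemma witness_ideal_ideal:
  assumes a: "a \<in> carrier R"
  shows "ideal (witness_ideal a) P"
proof -
  interpret J: ideal "PIdl (a \<otimes> a)" R
    using a by (simp add: R.cgenideal_ideal)
  interpret A: ideal "PIdl a" R
    using a by (rule R.cgenideal_ideal)
  have minus_closed: "\<ominus>\<^bsub>P\<^esub> p \<in> witness_ideal a" if "p \<in> witness_ideal a" for p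
  proof -
    have "p \<in> carrier P"
      using that by (simp add: witness_ideal_def)
    \<comment> \<open>Negation is multiplication by -1, so closure under multiplication covers
      it.\<close>
    then have "\<ominus>\<^bsub>P\<^esub> p = \<ominus>\<^bsub>P\<^esub> \<one>\<^bsub>P\<^esub> \<otimes>\<^bsub>P\<^esub> p"
      by (simp add: P.l_minus)
    then show ?thesis
      using witness_ideal_mult_closed[OF a that] by simp
  qed
  have add_closed: "p \<oplus>\<^bsub>P\<^esub> q \<in> witness_ideal a"
    if p: "p \<in> witness_ideal a" and q: "q \<in> witness_ideal a" for p q
  proof -
    have c: "p \<in> carrier P" "q \<in> carrier P"
      using p q by (simp_all add: witness_ideal_def)
    have "up_ring.coeff P p 0 \<oplus> up_ring.coeff P q 0 \<oplus> a \<otimes> (up_ring.coeff P p 2 \<oplus> up_ring.coeff P q 2)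
      = (up_ring.coeff P p 0 \<oplus> a \<otimes> up_ring.coeff P p 2) \<oplus> (up_ring.coeff P q 0 \<oplus> a \<otimes> up_ring.coeff P q 2)"
      using a coeff_closed[OF c(1)] coeff_closed[OF c(2)]
      by (simp add: R.r_distr R.a_ac)
    then show ?thesis
      using p q c by (simp add: witness_ideal_def)
  qed
  show ?thesis
  proof (rule idealI[OF UP_ring P.add.subgroupI])
    show "witness_ideal a \<subseteq> carrier P"
      by (auto simp: witness_ideal_def)
    have "\<zero>\<^bsub>P\<^esub> \<in> witness_ideal a"
      using a by (simp add: witness_ideal_def)
    then show "witness_ideal a \<noteq> {}"
      by blast
  next
    fix p x assume "p \<in> witness_ideal a" "x \<in> carrier P"
    then show "x \<otimes>\<^bsub>P\<^esub> p \<in> witness_ideal a" "p \<otimes>\<^bsub>P\<^esub> x \<in> witness_ideal a"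
      using witness_ideal_mult_closed[OF a] UP_m_comm by (auto simp: witness_ideal_def)
  qed (use minus_closed add_closed in \<open>auto simp: a_inv_def\<close>)
qed

text \<open>A constant has zero coefficients in degrees 1 and 2, so only the condition on its value
  remains.\<close>

lemma contraction_witness_ideal:
  assumes a: "a \<in> carrier R"
  shows "contraction R (witness_ideal a) = PIdl (a \<otimes> a)"
proof -
  interpret J: ideal "PIdl (a \<otimes> a)" R
    using a by (simp add: R.cgenideal_ideal)
  interpret A: ideal "PIdl a" R
    using a by (rule R.cgenideal_ideal)
  show ?thesis
    using a by (auto simp: contraction_def witness_ideal_def simp flip: P_def)
qed

lemma cube_mem_contraction_witness_ideal_square:
  assumes a: "a \<in> carrier R"
  shows "a \<otimes> (a \<otimes> a) \<in> contraction R (witness_ideal a \<cdot>\<^bsub>P\<^esub> witness_ideal a)"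
proof -
  interpret J: ideal "PIdl (a \<otimes> a)" R
    using a by (simp add: R.cgenideal_ideal)
  interpret A: ideal "PIdl a" R
    using a by (rule R.cgenideal_ideal)
  let ?M = "up_ring.monom P"
  define X2 where "X2 = ?M \<one> 2 \<oplus>\<^bsub>P\<^esub> ?M (\<ominus> a) 0"
  \<comment> \<open>The three generators, the first up to sign. For \<open>X2\<close> the condition
    reads -a + a*1 = 0, which explains the weight \<open>a\<close> on the degree 2
    coefficient.\<close>
  have aX: "?M a 1 \<in> witness_ideal a"
    using a by (simp add: witness_ideal_def R.cgenideal_self)
  have a2: "?M (\<ominus> (a \<otimes> a)) 0 \<in> witness_ideal a"
    using a by (simp add: witness_ideal_def R.cgenideal_self)
  have X2: "X2 \<in> witness_ideal a"
    using a by (simp add: witness_ideal_def X2_def R.l_neg)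
  have sq: "?M a 1 \<otimes>\<^bsub>P\<^esub> ?M a 1 = ?M (a \<otimes> a) 2"
    using a monom_mult[of a a 1 1] by (simp add: numeral_2_eq_2 del: monom_mult)
  have m2: "?M (\<ominus> (a \<otimes> a)) 0 \<otimes>\<^bsub>P\<^esub> ?M \<one> 2 = ?M (\<ominus> (a \<otimes> a)) 2"
    using a monom_mult[of "\<ominus> (a \<otimes> a)" \<one> 0 2]
    by (simp add: numeral_2_eq_2 del: monom_mult monom_a_inv)
  have m0: "?M (\<ominus> (a \<otimes> a)) 0 \<otimes>\<^bsub>P\<^esub> ?M (\<ominus> a) 0 = ?M (a \<otimes> (a \<otimes> a)) 0"
    using a monom_mult[of "\<ominus> (a \<otimes> a)" "\<ominus> a" 0 0]
    by (simp del: monom_mult monom_a_inv add: R.l_minus R.r_minus R.m_assoc)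
  have prod: "?M (\<ominus> (a \<otimes> a)) 0 \<otimes>\<^bsub>P\<^esub> X2
      = ?M (\<ominus> (a \<otimes> a)) 2 \<oplus>\<^bsub>P\<^esub> ?M (a \<otimes> (a \<otimes> a)) 0"
    using a by (simp add: X2_def P.r_distr m2 m0 del: monom_mult monom_a_inv)
  \<comment> \<open>With the sign absorbed into the constant -a^2, this is a sum of two products of
    elements of the ideal; the degree 2 terms cancel.\<close>
  have "?M (a \<otimes> (a \<otimes> a)) 0
      = ?M a 1 \<otimes>\<^bsub>P\<^esub> ?M a 1 \<oplus>\<^bsub>P\<^esub> ?M (\<ominus> (a \<otimes> a)) 0 \<otimes>\<^bsub>P\<^esub> X2"
    unfolding sq prod using a
    by (intro up_eqI) (auto simp: R.r_neg simp del: monom_mult monom_a_inv)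
  then have "?M (a \<otimes> (a \<otimes> a)) 0 \<in> witness_ideal a \<cdot>\<^bsub>P\<^esub> witness_ideal a"
    using aX a2 X2 by (simp only: ideal_prod.sum ideal_prod.prod)
  then show ?thesis
    using a by (simp add: contraction_def flip: P_def)
qed

end

theorem theorem3p18:
  fixes R :: "('a, 'm) ring_scheme"
  assumes "domain R"
    and "\<And>I. ideal I (UP R) \<Longrightarrow> power_stable R I"
  shows "field R"
proof -
  interpret R: domain R by fact
  interpret UP_cring R "UP R"
    by unfold_locales
  have "a \<in> Units R" if a: "a \<in> carrier R" and nz: "a \<noteq> \<zero>\<^bsub>R\<^esub>" for a
  proof -
    let ?I = "witness_ideal a"
    have I: "ideal ?I (UP R)"
      using a by (rule witness_ideal_ideal)
    \<comment> \<open>Power stability at t = 2: the square of the ideal contracts to (a^2)^2 =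
      (a^4).\<close>
    have "contraction R (?I [^]\<^bsub>ideals_set (UP R)\<^esub> (2::nat))
        = contraction R ?I [^]\<^bsub>ideals_set R\<^esub> (2::nat)"
      using assms(2)[OF I] by (simp add: power_stable_def)
    then have "contraction R (?I \<cdot>\<^bsub>UP R\<^esub> ?I) = PIdl\<^bsub>R\<^esub> ((a \<otimes>\<^bsub>R\<^esub> a) \<otimes>\<^bsub>R\<^esub> (a \<otimes>\<^bsub>R\<^esub> a))"
      using a I by (simp add: P.ideals_set_pow_2 R.ideals_set_pow_2 contraction_witness_ideal
          R.cgenideal_ideal R.cgenideal_ideal_prod)
    then obtain r where r: "r \<in> carrier R"
      and eq: "a \<otimes>\<^bsub>R\<^esub> (a \<otimes>\<^bsub>R\<^esub> a) = r \<otimes>\<^bsub>R\<^esub> ((a \<otimes>\<^bsub>R\<^esub> a) \<otimes>\<^bsub>R\<^esub> (a \<otimes>\<^bsub>R\<^esub> a))"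
      using cube_mem_contraction_witness_ideal_square[OF a] by (auto simp: cgenideal_def)
    \<comment> \<open>Both sides equal a^3 by \<open>eq\<close>. Since a^3 is nonzero in a domain,
      it cancels and \<open>r\<close> is an inverse of \<open>a\<close>.\<close>
    have "(a \<otimes>\<^bsub>R\<^esub> (a \<otimes>\<^bsub>R\<^esub> a)) \<otimes>\<^bsub>R\<^esub> (r \<otimes>\<^bsub>R\<^esub> a) = r \<otimes>\<^bsub>R\<^esub> ((a \<otimes>\<^bsub>R\<^esub> a) \<otimes>\<^bsub>R\<^esub> (a \<otimes>\<^bsub>R\<^esub> a))"
      using a r by (simp add: R.m_ac)
    then have "(a \<otimes>\<^bsub>R\<^esub> (a \<otimes>\<^bsub>R\<^esub> a)) \<otimes>\<^bsub>R\<^esub> (r \<otimes>\<^bsub>R\<^esub> a) = (a \<otimes>\<^bsub>R\<^esub> (a \<otimes>\<^bsub>R\<^esub> a)) \<otimes>\<^bsub>R\<^esub> \<one>\<^bsub>R\<^esub>"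
      using a by (simp flip: eq)
    then have "r \<otimes>\<^bsub>R\<^esub> a = \<one>\<^bsub>R\<^esub>"
      by (subst (asm) R.m_lcancel) (use a r nz in \<open>auto simp: R.integral_iff\<close>)
    then show ?thesis
      using a r by (auto simp: Units_def R.m_comm[of a r])
  qed
  moreover have "\<zero>\<^bsub>R\<^esub> \<notin> Units R"
    by (simp add: Units_def)
  ultimately show ?thesis
    by (intro R.cring_fieldI) blast
qed

end
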